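(* Let $\alpha\in\mathbb{R}$ with $\sin\alpha\neq 0$, and let $\gamma$ be a hedgehog whose support function $p$ is not identically zero, the origin being chosen at the Steiner point of $\gamma$ (so that the Fourier series of $p$ contains no first harmonics). (i) Assume that $p$ is a trigonometric polynomial of degree $d$ (and, if $d=0$, that $\cos\alpha\neq 0$). Then the iterated skew evolutes $\mathcal{E}_\alpha^n(\gamma)$ converge in shape, as $n\to\infty$, to a hypocycloid of order $d$. (ii) Assume $\cos\alpha\ne 0$. If the Fourier series of $p$ has a nonzero free (constant) term, then the iterated skew involutes $\mathcal{I}_\alpha^n(\gamma)$ converge in shape, as $n\to\infty$, to a circle. If the Fourier series of $p$ starts with the $d$th harmonics (that is, the constant term and all $k$th harmonics with $k<d$ vanish, and the $d$th harmonic is nonzero, $d\ge 2$), then the iterated skew involutes $\mathcal{I}_\alpha^n(\gamma)$ converge in shape to a hypocycloid of order $d$.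
   Context: All functions are $C^\infty$. A hedgehog is a cooriented closed plane curve $\gamma$ given by a $2\pi$-periodic support function $p:\mathbb{R}/2\pi\mathbb{Z}\to\mathbb{R}$, where $p(\phi)$ is the signed distance from the origin to the tangent line of $\gamma$ whose coorienting normal is $(\cos\phi,\sin\phi)$; explicitly $\gamma(\phi)=(p(\phi)\cos\phi-p'(\phi)\sin\phi,\ p(\phi)\sin\phi+p'(\phi)\cos\phi)$. Every $2\pi$-periodic $p$ defines a hedgehog, and hedgehogs are identified with their support functions. Changing the origin amounts to adding to $p$ a first harmonic (a linear combination of $\cos\phi$, $\sin\phi$). The Steiner point of $\gamma$ is $\frac1\pi\int_0^{2\pi}p(\phi)(\cos\phi,\sin\phi)\,d\phi$. For an angle $\alpha$, the skew evolute $\mathcal{E}_\alpha(\gamma)$ is the envelope of the lines obtained by turning each tangent line of $\gamma$ through angle $\alpha$ about its tangency point. In terms of support functions, it is the hedgehog with support function $$q(\phi)=p(\phi-\alpha)\cos\alpha+p'(\phi-\alpha)\sin\alpha .$$ If $\cos\alpha\ne0$, this map on hedgehogs is invertible; the skew involute map is $\mathcal{I}_\alpha=\mathcal{E}_\alpha^{-1}$, i.e. $\mathcal{I}_\alpha(\Gamma)$ is the unique hedgehog $\gamma$ with $\mathcal{E}_\alpha(\gamma)=\Gamma$. The $k$th harmonics are the linear combinations of $\cos(k\phi)$ and $\sin(k\phi)$. A hypocycloid of order $k\ge2$ is a hedgehog whose support function is a nonzero $k$th harmonic; circles (nonzero constant support function) are regarded as hypocycloids of order $0$. A sequence of hedgehogs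 $\gamma_n$ with support functions $p_n$ (all with Steiner point at the origin) converges in shape to a hedgehog with support function $p_\infty$ if there are nonzero real numbers $\lambda_n$ (scalings) and angles $\theta_n$ (rotations) such that the functions $\phi\mapsto\lambda_n p_n(\phi-\theta_n)$ converge to $p_\infty$ uniformly together with their first derivatives (so that the rescaled and rotated curves converge uniformly). *)

theory Defs
  imports "HOL-Analysis.Analysis"
begin

text \<open>Hedgehogs are identified with their support functions, and functions on the circle
  with \<open>2\<pi>\<close>-periodic functions on the real line.\<close>

definition smooth :: "(real \<Rightarrow> real) \<Rightarrow> bool" where
  "smooth f \<longleftrightarrow> (\<forall>n x. (deriv ^^ n) f differentiable (at x))"

definition hedgehog :: "(real \<Rightarrow> real) \<Rightarrow> bool" where
  "hedgehog p \<longleftrightarrow> smooth p \<and> (\<forall>\<phi>. p (\<phi> + 2 * pi) = p \<phi>)"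

definition hedgehog_curve :: "(real \<Rightarrow> real) \<Rightarrow> real \<Rightarrow> real \<times> real" where
  "hedgehog_curve p \<phi> =
     (p \<phi> * cos \<phi> - deriv p \<phi> * sin \<phi>, p \<phi> * sin \<phi> + deriv p \<phi> * cos \<phi>)"

definition steiner_point :: "(real \<Rightarrow> real) \<Rightarrow> real \<times> real" where
  "steiner_point p =
     (1 / pi) *\<^sub>R integral {0..2 * pi} (\<lambda>\<phi>. p \<phi> *\<^sub>R (cos \<phi>, sin \<phi>))"

definition skew_evolute :: "real \<Rightarrow> (real \<Rightarrow> real) \<Rightarrow> real \<Rightarrow> real" where
  "skew_evolute \<alpha> p \<phi> = p (\<phi> - \<alpha>) * cos \<alpha> + deriv p (\<phi> - \<alpha>) * sin \<alpha>"

text \<open>Turning the tangent line at the point with parameter \<open>\<phi>\<close> by the angle \<open>\<alpha>\<close> gives the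
  line through that point with normal direction \<open>\<phi> + \<alpha>\<close>; its signed distance from the origin
  is the value of the skew evolute's support function at \<open>\<phi> + \<alpha>\<close>.\<close>

lemma skew_evolute_turned_tangent:
  "skew_evolute \<alpha> p (\<phi> + \<alpha>) = hedgehog_curve p \<phi> \<bullet> (cos (\<phi> + \<alpha>), sin (\<phi> + \<alpha>))"
proof -
  have "cos \<alpha> = cos \<phi> * cos (\<phi> + \<alpha>) + sin \<phi> * sin (\<phi> + \<alpha>)"
    using cos_diff[of "\<phi> + \<alpha>" \<phi>] by (simp add: mult.commute)
  moreover have "sin \<alpha> = cos \<phi> * sin (\<phi> + \<alpha>) - sin \<phi> * cos (\<phi> + \<alpha>)"
    using sin_diff[of "\<phi> + \<alpha>" \<phi>] by (simp add: mult.commute)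
  ultimately show ?thesis
    by (simp only: skew_evolute_def hedgehog_curve_def inner_Pair inner_real_def
        add_diff_cancel_right') (simp add: algebra_simps)
qed

text \<open>Meaningful for \<open>cos \<alpha> \<noteq> 0\<close>, when the skew evolute map on hedgehogs is invertible.\<close>

definition skew_involute :: "real \<Rightarrow> (real \<Rightarrow> real) \<Rightarrow> real \<Rightarrow> real" where
  "skew_involute \<alpha> q = (THE p. hedgehog p \<and> skew_evolute \<alpha> p = q)"

definition harmonic :: "nat \<Rightarrow> (real \<Rightarrow> real) \<Rightarrow> bool" where
  "harmonic k h \<longleftrightarrow> (\<exists>a b. h = (\<lambda>\<phi>. a * cos (real k * \<phi>) + b * sin (real k * \<phi>)))"

text \<open>For \<open>k = 0\<close> the harmonics are the constant functions, so the hypocycloids of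
  order \<open>0\<close> are the circles.\<close>

definition hypocycloid :: "nat \<Rightarrow> (real \<Rightarrow> real) \<Rightarrow> bool" where
  "hypocycloid k h \<longleftrightarrow> k \<noteq> 1 \<and> harmonic k h \<and> h \<noteq> (\<lambda>\<phi>. 0)"

definition circle :: "(real \<Rightarrow> real) \<Rightarrow> bool" where
  "circle h \<longleftrightarrow> (\<exists>c. c \<noteq> 0 \<and> h = (\<lambda>\<phi>. c))"

lemma hypocycloid_0_iff_circle: "hypocycloid 0 h \<longleftrightarrow> circle h"
  by (auto simp: hypocycloid_def circle_def harmonic_def fun_eq_iff)

definition trig_polynomial_of_degree :: "nat \<Rightarrow> (real \<Rightarrow> real) \<Rightarrow> bool" where
  "trig_polynomial_of_degree d p \<longleftrightarrow>
     (\<exists>h. (\<forall>k\<le>d. harmonic k (h k)) \<and> h d \<noteq> (\<lambda>\<phi>. 0) \<and> p = (\<lambda>\<phi>. \<Sum>k\<le>d. h k \<phi>))"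

definition fourier_cos_coeff :: "(real \<Rightarrow> real) \<Rightarrow> nat \<Rightarrow> real" where
  "fourier_cos_coeff p k = (1 / pi) * integral {0..2 * pi} (\<lambda>\<phi>. p \<phi> * cos (real k * \<phi>))"

definition fourier_sin_coeff :: "(real \<Rightarrow> real) \<Rightarrow> nat \<Rightarrow> real" where
  "fourier_sin_coeff p k = (1 / pi) * integral {0..2 * pi} (\<lambda>\<phi>. p \<phi> * sin (real k * \<phi>))"

text \<open>The \<open>k\<close>th harmonic in the Fourier series of \<open>p\<close>.\<close>

definition fourier_term :: "(real \<Rightarrow> real) \<Rightarrow> nat \<Rightarrow> real \<Rightarrow> real" where
  "fourier_term p k \<phi> =
     (if k = 0 then fourier_cos_coeff p 0 / 2
      else fourier_cos_coeff p k * cos (real k * \<phi>) + fourier_sin_coeff p k * sin (real k * \<phi>))"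

definition converges_in_shape :: "(nat \<Rightarrow> real \<Rightarrow> real) \<Rightarrow> (real \<Rightarrow> real) \<Rightarrow> bool" where
  "converges_in_shape P h \<longleftrightarrow>
     (\<forall>n. hedgehog (P n) \<and> steiner_point (P n) = 0) \<and> hedgehog h \<and>
     (\<exists>(c :: nat \<Rightarrow> real) (\<theta> :: nat \<Rightarrow> real).
        (\<forall>n. c n \<noteq> 0) \<and>
        uniform_limit UNIV (\<lambda>n \<phi>. c n * P n (\<phi> - \<theta> n)) h sequentially \<and>
        uniform_limit UNIV (\<lambda>n. deriv (\<lambda>\<phi>. c n * P n (\<phi> - \<theta> n))) (deriv h) sequentially)"

end

theory Submission
  imports Defs
begin

text \<open>
  Both maps are diagonal in the Fourier basis. The skew evolute multiplies the \<open>k\<close>th complex Fourier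
  coefficient of the support function by \<open>cis (- k \<alpha>) (cos \<alpha> + i k sin \<alpha>)\<close>, a number with squared modulus
  \<open>cos\<^sup>2 \<alpha> + k\<^sup>2 sin\<^sup>2 \<alpha>\<close>; the skew involute divides by it. For \<open>sin \<alpha> \<noteq> 0\<close> the modulus is strictly
  increasing in \<open>k\<close>. Hence iterated evolutes are dominated by the highest harmonic and iterated involutes
  by the lowest one: dividing by the \<open>n\<close>th power of the dominant modulus and rotating back by \<open>n / d\<close> times
  its argument keeps the dominant harmonic fixed, while every other one decays geometrically with a common
  ratio less than \<open>1\<close>. This is \<open>converges_in_shape_dominant_harmonic\<close>, which serves both parts.

  Uniform convergence needs that a hedgehog is the sum of its Fourier series (\<open>fourier_sums\<close>) and that the
  coefficients are absolutely summable (\<open>fourier_coeff_summable\<close>). The first follows from the Dirichlet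
  kernel and the Riemann--Lebesgue lemma, the second from two integrations by parts. Together with the same statement
  for the derivatives, whose coefficients carry the extra factor \<open>i k\<close>, this gives convergence of the curves.

  That the involute map is defined at all is the solvability of the periodic linear differential equation
  \<open>p' sin \<alpha> + p cos \<alpha> = q (_ + \<alpha>)\<close> for \<open>cos \<alpha> \<noteq> 0\<close>: existence is \<open>periodic_linear_ode\<close>, and uniqueness
  holds because a hedgehog is determined by its Fourier coefficients (\<open>hedgehog_eq_fourier_coeff\<close>).
\<close>

section \<open>Smooth periodic functions\<close>

text \<open>Smoothness as the largest class of differentiable functions that is closed under
  differentiation: this replaces inductions over the order of the derivative.\<close>

lemma smooth_coinduct:
  assumes "f \<in> F" and step: "\<And>g. g \<in> F \<Longrightarrow> (\<forall>x. g differentiable (at x)) \<and> deriv g \<in> F"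
  shows "smooth f"
proof -
  have "(deriv ^^ n) f \<in> F" for n
    by (induction n) (use assms in auto)
  with step show ?thesis by (auto simp: smooth_def)
qed

lemma smooth_DERIV: "smooth f \<Longrightarrow> (f has_real_derivative deriv f x) (at x)"
  unfolding smooth_def DERIV_deriv_iff_real_differentiable by (metis funpow_0)

lemma smooth_deriv: "smooth f \<Longrightarrow> smooth (deriv f)"
  unfolding smooth_def by (metis comp_apply funpow_Suc_right)

lemma smooth_continuous_on: "smooth f \<Longrightarrow> continuous_on S f"
  by (rule DERIV_continuous_on[OF has_field_derivative_at_within[OF smooth_DERIV]])

lemma smooth_lincomb:
  assumes "smooth u" "smooth v"
  shows "smooth (\<lambda>x. c * u x + d * v x)"
proof (rule smooth_coinduct[of _ "{h. \<exists>u v. smooth u \<and> smooth v \<and> h = (\<lambda>x. c * u x + d * v x)}"])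
  fix h assume "h \<in> {h. \<exists>u v. smooth u \<and> smooth v \<and> h = (\<lambda>x. c * u x + d * v x)}"
  then obtain u v where uv: "smooth u" "smooth v" and h: "h = (\<lambda>x. c * u x + d * v x)"
    by blast
  have D: "(h has_real_derivative c * deriv u x + d * deriv v x) (at x)" for x
    unfolding h by (auto intro!: derivative_eq_intros smooth_DERIV uv)
  then have "deriv h = (\<lambda>x. c * deriv u x + d * deriv v x)"
    by (auto simp: DERIV_imp_deriv)
  then show "(\<forall>x. h differentiable (at x)) \<and> deriv h \<in> {h. \<exists>u v. smooth u \<and> smooth v \<and> h = (\<lambda>x. c * u x + d * v x)}"
    using D uv smooth_deriv by (auto simp: real_differentiable_def)
qed (use assms in auto)

text \<open>The functions \<open>u + b f\<close> with \<open>u\<close> smooth form a class that is closed under differentiation,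
  because the equation expresses \<open>f'\<close> in the same form.\<close>

lemma smooth_linear_ode:
  assumes "smooth g" and f: "\<And>x. (f has_real_derivative g x + a * f x) (at x)"
  shows "smooth f"
proof (rule smooth_coinduct[of _ "{h. \<exists>u b. smooth u \<and> h = (\<lambda>x. u x + b * f x)}"])
  have "smooth (\<lambda>x. 0)"
    using smooth_lincomb[OF assms(1,1), of 0 0] by simp
  then show "f \<in> {h. \<exists>u b. smooth u \<and> h = (\<lambda>x. u x + b * f x)}"
    by (intro CollectI exI[of _ "\<lambda>x. 0"] exI[of _ 1]) auto
next
  fix h assume "h \<in> {h. \<exists>u b. smooth u \<and> h = (\<lambda>x. u x + b * f x)}"
  then obtain u b where u: "smooth u" and h: "h = (\<lambda>x. u x + b * f x)"
    by blast
  have D: "(h has_real_derivative (1 * deriv u x + b * g x) + (b * a) * f x) (at x)" for x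
    unfolding h by (auto intro!: derivative_eq_intros smooth_DERIV u f simp: algebra_simps)
  then have "deriv h = (\<lambda>x. (1 * deriv u x + b * g x) + (b * a) * f x)"
    by (auto simp: DERIV_imp_deriv)
  with D show "(\<forall>x. h differentiable (at x)) \<and> deriv h \<in> {h. \<exists>u b. smooth u \<and> h = (\<lambda>x. u x + b * f x)}"
    using smooth_lincomb[OF smooth_deriv[OF u] assms(1), of 1 b]
    by (auto simp: real_differentiable_def)
qed

lemma deriv_translate:
  assumes "smooth f"
  shows "deriv (\<lambda>x. f (x + a)) = (\<lambda>x. deriv f (x + a))"
  by (rule ext, rule DERIV_imp_deriv) (simp add: DERIV_shift[symmetric] smooth_DERIV assms)

lemma smooth_translate:
  assumes "smooth f"
  shows "smooth (\<lambda>x. f (x + a))"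
proof (rule smooth_coinduct[of _ "{h. \<exists>u. smooth u \<and> h = (\<lambda>x. u (x + a))}"])
  fix h assume "h \<in> {h. \<exists>u. smooth u \<and> h = (\<lambda>x. u (x + a))}"
  then obtain u where u: "smooth u" and h: "h = (\<lambda>x. u (x + a))" by blast
  have "(h has_real_derivative deriv u (x + a)) (at x)" for x
    unfolding h using smooth_DERIV[OF u, of "x + a"] by (simp add: DERIV_shift)
  then show "(\<forall>x. h differentiable (at x)) \<and> deriv h \<in> {h. \<exists>u. smooth u \<and> h = (\<lambda>x. u (x + a))}"
    using u smooth_deriv deriv_translate[OF u] by (auto simp: real_differentiable_def h)
qed (use assms in auto)

lemma hedgehog_deriv: "hedgehog f \<Longrightarrow> hedgehog (deriv f)"
  using smooth_deriv[of f] deriv_translate[of f "2 * pi"] unfolding hedgehog_def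
  by (auto simp: fun_eq_iff)

lemma hedgehog_translate: "hedgehog f \<Longrightarrow> hedgehog (\<lambda>x. f (x + a))"
  unfolding hedgehog_def using smooth_translate[of f a]
  by (simp add: add.assoc add.commute[of _ a]) (simp add: add.assoc[symmetric])

lemma hedgehog_lincomb: "hedgehog f \<Longrightarrow> hedgehog g \<Longrightarrow> hedgehog (\<lambda>x. a * f x + b * g x)"
  unfolding hedgehog_def using smooth_lincomb[of f g a b] by auto

lemma hedgehog_smooth: "hedgehog f \<Longrightarrow> smooth f"
  by (simp add: hedgehog_def)

lemma hedgehog_periodic: "hedgehog f \<Longrightarrow> f (x + 2 * pi) = f x"
  by (simp add: hedgehog_def)

lemmas hedgehog_DERIV = smooth_DERIV[OF hedgehog_smooth]
lemmas hedgehog_continuous_on = smooth_continuous_on[OF hedgehog_smooth]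

lemma cos_sin_periodic_nat:
  "cos (real k * (x + 2 * pi)) = cos (real k * x)" "sin (real k * (x + 2 * pi)) = sin (real k * x)"
proof -
  have *: "real k * (x + 2 * pi) = real k * x + 2 * real k * pi"
    by (simp add: algebra_simps)
  show "cos (real k * (x + 2 * pi)) = cos (real k * x)" "sin (real k * (x + 2 * pi)) = sin (real k * x)"
    unfolding * by (simp_all add: cos_add sin_add)
qed

lemma harmonic_DERIV:
  "((\<lambda>x. a * cos (real k * x) + b * sin (real k * x)) has_real_derivative
    (b * k) * cos (real k * x) + (- a * k) * sin (real k * x)) (at x)"
  by (auto intro!: derivative_eq_intros)

lemma deriv_harmonic:
  "deriv (\<lambda>x. a * cos (real k * x) + b * sin (real k * x)) =
    (\<lambda>x. (b * k) * cos (real k * x) + (- a * k) * sin (real k * x))"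
  using DERIV_imp_deriv[OF harmonic_DERIV] by (rule ext)

lemma harmonic_hedgehog:
  assumes "harmonic k h"
  shows "hedgehog h"
  unfolding hedgehog_def
proof
  show "smooth h"
  proof (rule smooth_coinduct[of _ "Collect (harmonic k)"])
    fix g assume "g \<in> Collect (harmonic k)"
    then obtain a b where g: "g = (\<lambda>x. a * cos (real k * x) + b * sin (real k * x))"
      by (auto simp: harmonic_def)
    show "(\<forall>x. g differentiable (at x)) \<and> deriv g \<in> Collect (harmonic k)"
      unfolding g deriv_harmonic using harmonic_DERIV[of a k b]
      by (blast intro: real_differentiable_def[THEN iffD2] harmonic_def[THEN iffD2])
  qed (use assms in auto)
  show "\<forall>x. h (x + 2 * pi) = h x"
    using assms unfolding harmonic_def by (auto simp: cos_sin_periodic_nat)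
qed

section \<open>Complex Fourier coefficients\<close>

text \<open>The complex form of the \<open>k\<close>th harmonic, with the normalisation of the real coefficients
  \<open>fourier_cos_coeff\<close> and \<open>fourier_sin_coeff\<close>, so that \<open>fourier_coeff f 0\<close> is twice the mean of \<open>f\<close>. Since the
  functions are real, the coefficients with negative index are the conjugates of these.\<close>

definition fourier_coeff :: "(real \<Rightarrow> real) \<Rightarrow> nat \<Rightarrow> complex" where
  "fourier_coeff f k = integral {0..2 * pi} (\<lambda>t. f t *\<^sub>R cis (- (real k * t))) / pi"

lemma fourier_coeff_has_integral:
  assumes "continuous_on {0..2 * pi} f"
  shows "((\<lambda>t. f t *\<^sub>R cis (- (real k * t))) has_integral pi * fourier_coeff f k) {0..2 * pi}"
proof -
  have "(\<lambda>t. f t *\<^sub>R cis (- (real k * t))) integrable_on {0..2 * pi}"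
    by (intro integrable_continuous_real continuous_intros assms)
  then show ?thesis by (simp add: fourier_coeff_def has_integral_integral)
qed

lemma fourier_coeff_eq:
  assumes "continuous_on {0..2 * pi} f"
  shows "fourier_coeff f k = Complex (fourier_cos_coeff f k) (- fourier_sin_coeff f k)"
proof -
  have "((\<lambda>t. Re (f t *\<^sub>R cis (- (real k * t)))) has_integral Re (pi * fourier_coeff f k)) {0..2 * pi}"
       "((\<lambda>t. - Im (f t *\<^sub>R cis (- (real k * t)))) has_integral - Im (pi * fourier_coeff f k)) {0..2 * pi}"
    using has_integral_linear[OF fourier_coeff_has_integral[OF assms] bounded_linear_Re, of k]
      has_integral_neg[OF has_integral_linear[OF fourier_coeff_has_integral[OF assms] bounded_linear_Im], of k]
    by (simp_all add: o_def)
  then show ?thesis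
    by (simp add: fourier_cos_coeff_def fourier_sin_coeff_def complex_eq_iff integral_unique)
qed

lemma fourier_term_eq:
  assumes "continuous_on {0..2 * pi} f"
  shows "fourier_term f k x = (if k = 0 then 1 / 2 else 1) * Re (fourier_coeff f k * cis (real k * x))"
  by (simp add: fourier_coeff_eq[OF assms] fourier_term_def)

lemma fourier_coeff_lincomb:
  assumes "continuous_on {0..2 * pi} f" "continuous_on {0..2 * pi} g"
  shows "fourier_coeff (\<lambda>x. a * f x + b * g x) k = a * fourier_coeff f k + b * fourier_coeff g k"
proof -
  have "((\<lambda>t. a *\<^sub>R (f t *\<^sub>R cis (- (real k * t))) + b *\<^sub>R (g t *\<^sub>R cis (- (real k * t))))
    has_integral a *\<^sub>R (pi * fourier_coeff f k) + b *\<^sub>R (pi * fourier_coeff g k)) {0..2 * pi}"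
    by (intro has_integral_add has_integral_cmul fourier_coeff_has_integral assms)
  then have "((\<lambda>t. (a * f t + b * g t) *\<^sub>R cis (- (real k * t)))
    has_integral pi * (a * fourier_coeff f k + b * fourier_coeff g k)) {0..2 * pi}"
    by (simp add: algebra_simps scaleR_conv_of_real)
  then show ?thesis by (simp add: fourier_coeff_def integral_unique)
qed

lemma cis_has_vector_derivative:
  "((\<lambda>t. cis (- (real k * t))) has_vector_derivative - \<i> * k * cis (- (real k * t))) (at t within S)"
  unfolding has_vector_derivative_complex_iff
  by (auto intro!: derivative_eq_intros)

text \<open>Integration by parts, in which the boundary terms cancel by periodicity.\<close>

lemma fourier_coeff_deriv:
  assumes "hedgehog f"
  shows "fourier_coeff (deriv f) k = \<i> * k * fourier_coeff f k"
proof -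
  let ?e = "\<lambda>t. cis (- (real k * t))"
  have e: "(?e has_vector_derivative - \<i> * k * ?e t) (at t within S)" for t S
    by (rule cis_has_vector_derivative)
  have "((\<lambda>t. f t *\<^sub>R ?e t) has_vector_derivative (f t *\<^sub>R (- \<i> * k * ?e t) + deriv f t *\<^sub>R ?e t)) (at t within {0..2 * pi})" for t
    by (rule has_vector_derivative_scaleR[OF has_field_derivative_at_within[OF hedgehog_DERIV[OF assms]] e])
  then have "((\<lambda>t. f t *\<^sub>R (- \<i> * k * ?e t) + deriv f t *\<^sub>R ?e t) has_integral
      f (2 * pi) *\<^sub>R ?e (2 * pi) - f 0 *\<^sub>R ?e 0) {0..2 * pi}"
    by (intro fundamental_theorem_of_calculus) auto
  moreover have "f (2 * pi) *\<^sub>R ?e (2 * pi) - f 0 *\<^sub>R ?e 0 = 0"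
    using hedgehog_periodic[OF assms, of 0] cos_sin_periodic_nat[of k 0]
    by (simp add: complex_eq_iff)
  ultimately have "((\<lambda>t. - \<i> * k * (f t *\<^sub>R ?e t) + deriv f t *\<^sub>R ?e t) has_integral 0) {0..2 * pi}"
    by (simp only: scaleR_conv_of_real ac_simps)
  moreover have "((\<lambda>t. - \<i> * k * (f t *\<^sub>R ?e t) + deriv f t *\<^sub>R ?e t) has_integral
      - \<i> * k * (pi * fourier_coeff f k) + pi * fourier_coeff (deriv f) k) {0..2 * pi}"
    by (intro has_integral_add has_integral_mult_right fourier_coeff_has_integral
        hedgehog_continuous_on hedgehog_deriv assms)
  ultimately have "- \<i> * k * (pi * fourier_coeff f k) + pi * fourier_coeff (deriv f) k = 0"
    by (rule has_integral_unique[symmetric])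
  then have "pi * (fourier_coeff (deriv f) k - \<i> * k * fourier_coeff f k) = 0"
    by (simp add: algebra_simps)
  then show ?thesis by simp
qed

text \<open>By differentiation under the integral and \<open>fourier_coeff_deriv\<close>, the function
  \<open>x \<mapsto> cis (- k x) * fourier_coeff (f (_ + x)) k\<close> has derivative zero, so it equals its value at \<open>0\<close>.\<close>

lemma fourier_coeff_translate:
  assumes "hedgehog f"
  shows "fourier_coeff (\<lambda>t. f (t + x)) k = cis (real k * x) * fourier_coeff f k"
proof -
  let ?e = "\<lambda>t. cis (- (real k * t))"
  let ?C = "\<lambda>x. integral (cbox 0 (2 * pi)) (\<lambda>t. f (t + x) *\<^sub>R ?e t)"
  have C: "?C x = pi * fourier_coeff (\<lambda>t. f (t + x)) k" for x
    by (simp add: fourier_coeff_def)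
  have e: "(?e has_vector_derivative - \<i> * k * ?e t) (at t)" for t
    by (rule cis_has_vector_derivative)
  have "((\<lambda>x. ?e x * ?C x) has_derivative (\<lambda>h. 0)) (at x within UNIV)" for x
  proof -
    have "(?C has_vector_derivative integral (cbox 0 (2 * pi)) (\<lambda>t. deriv f (t + x) *\<^sub>R ?e t)) (at x within UNIV)"
    proof (rule leibniz_rule_vector_derivative)
      show "((\<lambda>x. f (t + x) *\<^sub>R ?e t) has_vector_derivative deriv f (t + x) *\<^sub>R ?e t) (at x within UNIV)" for x t
      proof -
        have "((\<lambda>x. f (x + t)) has_real_derivative deriv f (x + t)) (at x)"
          using hedgehog_DERIV[OF assms, of "x + t"] by (simp only: DERIV_shift)
        from has_vector_derivative_scaleR[OF this has_vector_derivative_const, of "?e t"]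
        show ?thesis by (simp add: add.commute)
      qed
      show "(\<lambda>t. f (t + x) *\<^sub>R ?e t) integrable_on cbox 0 (2 * pi)" for x
        unfolding cbox_interval
        by (intro integrable_continuous_real continuous_intros hedgehog_continuous_on[OF hedgehog_translate[OF assms]])
      have "continuous_on UNIV (deriv f)"
        by (intro hedgehog_continuous_on hedgehog_deriv assms)
      then have "continuous_on (UNIV \<times> cbox 0 (2 * pi)) (\<lambda>y. deriv f (snd y + fst y))"
        by (rule continuous_on_compose2) (auto intro!: continuous_intros)
      then show "continuous_on (UNIV \<times> cbox 0 (2 * pi)) (\<lambda>(x, t). deriv f (t + x) *\<^sub>R ?e t)"
        unfolding case_prod_beta by (rule continuous_on_scaleR) (intro continuous_intros)
    qed auto
    also have "integral (cbox 0 (2 * pi)) (\<lambda>t. deriv f (t + x) *\<^sub>R ?e t) = pi * fourier_coeff (deriv (\<lambda>t. f (t + x))) k"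
      by (simp add: fourier_coeff_def deriv_translate[OF hedgehog_smooth[OF assms]])
    also have "\<dots> = \<i> * k * ?C x"
      unfolding fourier_coeff_deriv[OF hedgehog_translate[OF assms]] C by simp
    finally have "((\<lambda>x. ?e x * ?C x) has_vector_derivative (?e x * (\<i> * k * ?C x) + - \<i> * k * ?e x * ?C x)) (at x)"
      by (intro has_vector_derivative_mult e) simp
    then show ?thesis by (simp add: has_vector_derivative_def)
  qed
  from has_derivative_zero_unique[OF convex_UNIV this, of x 0]
  have "cis (- (real k * x)) * fourier_coeff (\<lambda>t. f (t + x)) k = fourier_coeff f k"
    by (simp add: fourier_coeff_def)
  then have "cis (real k * x) * cis (- (real k * x)) * fourier_coeff (\<lambda>t. f (t + x)) k = cis (real k * x) * fourier_coeff f k"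
    by simp
  then show ?thesis by (simp add: cis_mult)
qed

section \<open>Fourier series of hedgehogs\<close>

lemma tendsto_quotient_of_zeros:
  fixes f g :: "real \<Rightarrow> real"
  assumes "(f has_real_derivative f') (at c)" "(g has_real_derivative g') (at c)" "g' \<noteq> 0"
    and "f c = 0" "g c = 0"
  shows "((\<lambda>x. f x / g x) \<longlongrightarrow> f' / g') (at c within S)"
proof -
  have "((\<lambda>x. ((f x - f c) / (x - c)) / ((g x - g c) / (x - c))) \<longlongrightarrow> f' / g') (at c)"
    using assms(1-3) unfolding has_field_derivative_iff by (intro tendsto_divide)
  then have "((\<lambda>x. f x / g x) \<longlongrightarrow> f' / g') (at c)"
    by (rule Lim_transform_eventually) (auto simp: eventually_at_filter assms(4,5))
  then show ?thesis by (rule tendsto_within_subset) simp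
qed

lemma integral_cos_nat:
  "((\<lambda>t. cos (real k * t)) has_integral (if k = 0 then 2 * pi else 0)) {0..2 * pi}"
proof (cases "k = 0")
  case True
  then show ?thesis using has_integral_const_real[of "1::real" 0 "2 * pi"] by simp
next
  case False
  have "((\<lambda>t. sin (real k * t) / k) has_vector_derivative cos (real k * t)) (at t within {0..2 * pi})" for t
    using False by (auto intro!: derivative_eq_intros simp flip: has_real_derivative_iff_has_vector_derivative)
  then have "((\<lambda>t. cos (real k * t)) has_integral sin (real k * (2 * pi)) / k - sin (real k * 0) / k) {0..2 * pi}"
    by (intro fundamental_theorem_of_calculus) auto
  then show ?thesis
    using False cos_sin_periodic_nat(2)[of k 0] by simp
qed

text \<open>Polynomials are dense, and for a polynomial one integration by parts gives a factor
  \<open>1 / l\<close>.\<close>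

lemma Riemann_Lebesgue:
  fixes g :: "real \<Rightarrow> real"
  assumes "continuous_on {a..b} g" "a \<le> b"
  shows "((\<lambda>l. integral {a..b} (\<lambda>t. g t * sin (l * t))) \<longlongrightarrow> 0) at_top"
proof (rule tendstoI)
  fix e :: real assume "e > 0"
  define e' where "e' = e / (2 * (b - a + 1))"
  have e': "e' > 0" "e' * (b - a) < e / 2"
    using \<open>e > 0\<close> assms(2) by (auto simp: e'_def field_simps)
  obtain q where q: "real_polynomial_function q" and gq: "\<And>t. t \<in> {a..b} \<Longrightarrow> \<bar>g t - q t\<bar> < e'"
    using Stone_Weierstrass_real_polynomial_function[OF compact_Icc assms(1) e'(1)] by blast
  obtain q' where q': "real_polynomial_function q'" "\<And>t. (q has_real_derivative q' t) (at t)"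
    using has_real_derivative_polynomial_function[OF q] by blast
  have cq: "continuous_on {a..b} q" and cq': "continuous_on {a..b} q'"
    using q q'(1) by (auto intro: continuous_on_polymonial_function simp: real_polynomial_function_eq)
  have "bounded (q' ` {a..b})"
    by (intro compact_imp_bounded compact_continuous_image cq' compact_Icc)
  then obtain M where "\<forall>y\<in>q' ` {a..b}. norm y \<le> M"
    unfolding bounded_iff by blast
  then have M: "\<bar>q' t\<bar> \<le> M" if "t \<in> {a..b}" for t
    using that by auto
  define C where "C = \<bar>q a\<bar> + \<bar>q b\<bar> + M * (b - a)"
  have bound: "\<bar>integral {a..b} (\<lambda>t. q t * sin (l * t))\<bar> \<le> C / l" if "l > 0" for l
  proof -
    have "((\<lambda>t. - q t * cos (l * t) / l) has_vector_derivative
        q t * sin (l * t) - q' t * cos (l * t) / l) (at t within {a..b})" for t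
      using that q'(2)[of t, THEN has_field_derivative_at_within, of "{a..b}"]
      by (auto intro!: derivative_eq_intros simp: field_simps simp flip: has_real_derivative_iff_has_vector_derivative)
    then have D: "((\<lambda>t. q t * sin (l * t) - q' t * cos (l * t) / l) has_integral
        - q b * cos (l * b) / l - - q a * cos (l * a) / l) {a..b}"
      using assms(2) by (intro fundamental_theorem_of_calculus) auto
    have Q: "((\<lambda>t. q' t * cos (l * t) / l) has_integral integral {a..b} (\<lambda>t. q' t * cos (l * t) / l)) {a..b}"
      using that by (intro integrable_integral integrable_continuous_real continuous_intros cq') auto
    have eq: "integral {a..b} (\<lambda>t. q t * sin (l * t)) =
        - q b * cos (l * b) / l - - q a * cos (l * a) / l + integral {a..b} (\<lambda>t. q' t * cos (l * t) / l)"
      using integral_unique[OF has_integral_add[OF D Q]] by simp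
    have "\<bar>integral {a..b} (\<lambda>t. q' t * cos (l * t) / l)\<bar> \<le> M / l * (b - a)"
    proof -
      have "\<bar>q' t * cos (l * t) / l\<bar> \<le> M / l" if "t \<in> {a..b}" for t
        using M[OF that] \<open>l > 0\<close> mult_mono[of "\<bar>q' t\<bar>" M "\<bar>cos (l * t)\<bar>" 1]
        by (auto simp: abs_mult intro!: divide_right_mono)
      moreover have "continuous_on {a..b} (\<lambda>t. q' t * cos (l * t) / l)"
        using that by (intro continuous_intros cq') auto
      ultimately show ?thesis
        using integral_bound[OF assms(2), of "\<lambda>t. q' t * cos (l * t) / l" "M / l"]
        by (simp only: real_norm_def)
    qed
    moreover have "\<bar>- q b * cos (l * b) / l - - q a * cos (l * a) / l\<bar> \<le> \<bar>q b\<bar> / l + \<bar>q a\<bar> / l"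
    proof -
      have "\<bar>q x * cos (l * x) / l\<bar> \<le> \<bar>q x\<bar> / l" for x
        using that by (auto simp: abs_mult intro!: divide_right_mono mult_left_le)
      from this[of a] this[of b] show ?thesis
        by (simp only: minus_mult_left[symmetric] minus_divide_left[symmetric])
    qed
    ultimately show ?thesis
      unfolding eq C_def add_divide_distrib times_divide_eq_left by linarith
  qed
  have "((\<lambda>l. C / l) \<longlongrightarrow> 0) at_top"
    by (intro real_tendsto_divide_at_top[OF tendsto_const filterlim_ident])
  then have "eventually (\<lambda>l. C / l < e / 2) at_top"
    using \<open>e > 0\<close> by (intro order_tendstoD) auto
  then show "eventually (\<lambda>l. dist (integral {a..b} (\<lambda>t. g t * sin (l * t))) 0 < e) at_top"
    using eventually_gt_at_top[of 0]
  proof eventually_elim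
    case (elim l)
    have "\<bar>integral {a..b} (\<lambda>t. (g t - q t) * sin (l * t))\<bar> \<le> e' * (b - a)"
    proof -
      have "\<bar>(g t - q t) * sin (l * t)\<bar> \<le> e'" if "t \<in> {a..b}" for t
        using gq[OF that] mult_mono[of "\<bar>g t - q t\<bar>" e' "\<bar>sin (l * t)\<bar>" 1]
        by (auto simp: abs_mult)
      moreover have "continuous_on {a..b} (\<lambda>t. (g t - q t) * sin (l * t))"
        by (intro continuous_intros cq assms(1))
      ultimately show ?thesis
        using integral_bound[OF assms(2), of "\<lambda>t. (g t - q t) * sin (l * t)" e']
        by (simp only: real_norm_def)
    qed
    moreover have "integral {a..b} (\<lambda>t. g t * sin (l * t)) =
        integral {a..b} (\<lambda>t. (g t - q t) * sin (l * t)) + integral {a..b} (\<lambda>t. q t * sin (l * t))"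
      by (subst Henstock_Kurzweil_Integration.integral_add[symmetric])
        (auto intro!: integrable_continuous_real continuous_intros cq assms(1) simp: algebra_simps)
    ultimately show ?case
      using bound[OF elim(2)] elim(1) e'(2) unfolding dist_norm diff_0_right real_norm_def by linarith
  qed
qed

text \<open>The product-to-sum formula makes the left-hand side telescope. The sum is half of the usual Dirichlet
  kernel, so that its integral over a period is \<open>\<pi>\<close>.\<close>

lemma Dirichlet_kernel:
  "2 * sin (t / 2) * (\<Sum>k\<le>N. (if k = 0 then 1 / 2 else 1) * cos (real k * t)) = sin ((real N + 1 / 2) * t)"
proof (induction N)
  case (Suc N)
  have "2 * sin (t / 2) * cos (real (Suc N) * t) = sin ((real (Suc N) + 1 / 2) * t) - sin ((real N + 1 / 2) * t)"
    using sin_add[of "real (Suc N) * t" "t / 2"] sin_diff[of "real (Suc N) * t" "t / 2"]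
    by (simp add: algebra_simps)
  with Suc show ?case by (simp add: distrib_left)
qed (simp add: algebra_simps)

text \<open>The partial sums of the series at \<open>0\<close> differ from \<open>f 0\<close> by the integral of \<open>f - f 0\<close> against the
  Dirichlet kernel. Because \<open>f\<close> is differentiable, \<open>f - f 0\<close> divided by the factor
  \<open>2 sin (t / 2)\<close> of \<open>Dirichlet_kernel\<close> is continuous up to the end points, and what remains is an
  integral against a fast oscillation, to which \<open>Riemann_Lebesgue\<close> applies.\<close>

lemma fourier_sums_at_0:
  assumes "hedgehog f"
  shows "(\<lambda>k. fourier_term f k 0) sums f 0"
proof -
  \<comment> \<open>The values at the end points are the limits there: \<open>2 sin (t / 2)\<close> has derivative \<open>1\<close> at \<open>0\<close> and \<open>-1\<close> at \<open>2\<pi>\<close>.\<close>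
  define g where "g t = (if t = 0 then deriv f 0 else if t = 2 * pi then - deriv f 0
      else (f t - f 0) / (2 * sin (t / 2)))" for t
  have f2pi: "f (2 * pi) = f 0" "deriv f (2 * pi) = deriv f 0"
    using hedgehog_periodic[OF assms, of 0] hedgehog_periodic[OF hedgehog_deriv[OF assms], of 0] by auto
  have lim: "((\<lambda>t. (f t - f 0) / (2 * sin (t / 2))) \<longlongrightarrow> deriv f c / cos (c / 2)) (at c within S)"
    if "c = 0 \<or> c = 2 * pi" for c S
    using that f2pi
    by (intro tendsto_quotient_of_zeros)
      (auto intro!: derivative_eq_intros hedgehog_DERIV assms)
  have ne: "sin (t / 2) \<noteq> 0" if "0 < t" "t < 2 * pi" for t
    using sin_gt_zero[of "t / 2"] that by auto
  have "continuous_on {0..2 * pi} g"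
  proof (rule continuous_on_IccI)
    have "eventually (\<lambda>t. t \<in> {0<..<2 * pi}) (at_right 0)"
      by (rule eventually_at_right_real) simp
    then have "eventually (\<lambda>t. (f t - f 0) / (2 * sin (t / 2)) = g t) (at_right 0)"
      by eventually_elim (auto simp: g_def)
    then show "(g \<longlongrightarrow> g 0) (at_right 0)"
      using lim[of 0 "{0<..}"] by (auto simp: g_def[of 0] intro: Lim_transform_eventually)
    have "eventually (\<lambda>t. t \<in> {0<..<2 * pi}) (at_left (2 * pi))"
      by (rule eventually_at_left_real) simp
    then have "eventually (\<lambda>t. (f t - f 0) / (2 * sin (t / 2)) = g t) (at_left (2 * pi))"
      by eventually_elim (auto simp: g_def)
    then show "(g \<longlongrightarrow> g (2 * pi)) (at_left (2 * pi))"
      using lim[of "2 * pi" "{..<2 * pi}"] f2pi by (auto simp: g_def[of "2 * pi"] intro: Lim_transform_eventually)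
    show "g \<midarrow>t\<rightarrow> g t" if t: "0 < t" "t < 2 * pi" for t
    proof -
      have "(\<lambda>t. (f t - f 0) / (2 * sin (t / 2))) \<midarrow>t\<rightarrow> (f t - f 0) / (2 * sin (t / 2))"
        using DERIV_isCont[OF hedgehog_DERIV[OF assms], of t] ne[OF t]
        by (intro tendsto_intros) (auto simp: isCont_def)
      moreover have "eventually (\<lambda>s. s \<in> {0<..<2 * pi}) (at t)"
        using t by (intro eventually_at_in_open') auto
      then have "eventually (\<lambda>t. (f t - f 0) / (2 * sin (t / 2)) = g t) (at t)"
        by eventually_elim (auto simp: g_def)
      ultimately show ?thesis
        using t by (auto simp: g_def[of t] intro: Lim_transform_eventually)
    qed
  qed auto
  from Riemann_Lebesgue[OF this]
  have "((\<lambda>l. integral {0..2 * pi} (\<lambda>t. g t * sin (l * t))) \<longlongrightarrow> 0) at_top" by simp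
  moreover have "filterlim (\<lambda>N. real N + 1 / 2) at_top sequentially"
    using filterlim_tendsto_add_at_top[OF tendsto_const[of "1/2"] filterlim_real_sequentially]
    by (simp add: add.commute)
  ultimately have RL: "(\<lambda>N. integral {0..2 * pi} (\<lambda>t. g t * sin ((real N + 1 / 2) * t))) \<longlonglongrightarrow> 0"
    by (rule filterlim_compose)
  have "integral {0..2 * pi} (\<lambda>t. g t * sin ((real N + 1 / 2) * t)) = pi * ((\<Sum>k\<le>N. fourier_term f k 0) - f 0)" for N
  proof -
    \<comment> \<open>The constant term enters a Fourier series with weight one half.\<close>
    let ?w = "\<lambda>k. if k = 0 then 1 / 2 else 1 :: real"
    have "((\<lambda>t. f t * cos (real k * t)) has_integral pi * fourier_cos_coeff f k) {0..2 * pi}" for k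
    proof -
      have "(\<lambda>t. f t * cos (real k * t)) integrable_on {0..2 * pi}"
        by (intro integrable_continuous_real continuous_intros hedgehog_continuous_on[OF assms])
      then show ?thesis by (simp add: fourier_cos_coeff_def has_integral_integral)
    qed
    then have "((\<lambda>t. \<Sum>k\<le>N. ?w k * (f t * cos (real k * t) - f 0 * cos (real k * t))) has_integral
        (\<Sum>k\<le>N. ?w k * (pi * fourier_cos_coeff f k - f 0 * (if k = 0 then 2 * pi else 0)))) {0..2 * pi}"
      by (intro has_integral_sum has_integral_mult_right has_integral_diff integral_cos_nat) auto
    also have "(\<Sum>k\<le>N. ?w k * (pi * fourier_cos_coeff f k - f 0 * (if k = 0 then 2 * pi else 0))) =
        (\<Sum>k\<le>N. pi * fourier_term f k 0 - (if k = 0 then pi * f 0 else 0))"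
      by (intro sum.cong) (auto simp: fourier_term_def field_simps)
    also have "\<dots> = pi * ((\<Sum>k\<le>N. fourier_term f k 0) - f 0)"
      by (simp add: sum_subtractf sum_distrib_left right_diff_distrib)
    finally have I: "((\<lambda>t. \<Sum>k\<le>N. ?w k * (f t * cos (real k * t) - f 0 * cos (real k * t))) has_integral \<dots>) {0..2 * pi}" .
    have "(\<Sum>k\<le>N. ?w k * (f t * cos (real k * t) - f 0 * cos (real k * t))) = g t * sin ((real N + 1 / 2) * t)"
      if "t \<in> {0..2 * pi}" for t
    proof -
      have "(\<Sum>k\<le>N. ?w k * (f t * cos (real k * t) - f 0 * cos (real k * t))) = (f t - f 0) * (\<Sum>k\<le>N. ?w k * cos (real k * t))"
        unfolding sum_distrib_left by (intro sum.cong) (auto simp: algebra_simps)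
      also have "\<dots> = g t * sin ((real N + 1 / 2) * t)"
      proof (cases "t = 0 \<or> t = 2 * pi")
        case True
        then have "sin ((real N + 1 / 2) * t) = 0"
          unfolding Dirichlet_kernel[symmetric] by auto
        with True f2pi show ?thesis by auto
      next
        case False
        then have "sin (t / 2) \<noteq> 0" using ne that by auto
        with False show ?thesis
          unfolding Dirichlet_kernel[symmetric] by (simp add: g_def)
      qed
      finally show ?thesis .
    qed
    from has_integral_eq[OF this I] show ?thesis by (simp add: integral_unique)
  qed
  then have "(\<lambda>N. pi * ((\<Sum>k\<le>N. fourier_term f k 0) - f 0)) \<longlonglongrightarrow> 0"
    using RL by simp
  then have "(\<lambda>N. (1 / pi) * (pi * ((\<Sum>k\<le>N. fourier_term f k 0) - f 0)) + f 0) \<longlonglongrightarrow> (1 / pi) * 0 + f 0"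
    by (intro tendsto_intros)
  then show ?thesis by (simp add: sums_def_le)
qed

text \<open>Translation moves the point of evaluation to \<open>0\<close>.\<close>

lemma fourier_sums:
  assumes "hedgehog f"
  shows "(\<lambda>k. fourier_term f k x) sums f x"
proof -
  let ?f = "\<lambda>t. f (t + x)"
  have h: "hedgehog ?f" by (rule hedgehog_translate[OF assms])
  have "fourier_term ?f k 0 = fourier_term f k x" for k
    unfolding fourier_term_eq[OF hedgehog_continuous_on[OF h]]
      fourier_term_eq[OF hedgehog_continuous_on[OF assms]] fourier_coeff_translate[OF assms]
    by (simp add: mult.commute)
  with fourier_sums_at_0[OF h] show ?thesis by simp
qed

lemma hedgehog_eq_fourier_coeff:
  assumes "hedgehog f" "hedgehog g" "\<And>k. fourier_coeff f k = fourier_coeff g k"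
  shows "f = g"
proof
  fix x
  have "(\<lambda>k. fourier_term f k x) = (\<lambda>k. fourier_term g k x)"
    by (simp add: fourier_term_eq[OF hedgehog_continuous_on] assms)
  then show "f x = g x"
    using fourier_sums[OF assms(1), of x] fourier_sums[OF assms(2), of x] sums_unique2 by fastforce
qed

text \<open>The coefficients of \<open>f''\<close> are bounded and equal \<open>- k\<^sup>2\<close> times those of \<open>f\<close>.\<close>

lemma fourier_coeff_summable:
  assumes "hedgehog f"
  shows "summable (\<lambda>k. norm (fourier_coeff f k))"
proof -
  let ?g = "deriv (deriv f)"
  have g: "hedgehog ?g" by (intro hedgehog_deriv assms)
  have "bounded (?g ` {0..2 * pi})"
    by (intro compact_imp_bounded compact_continuous_image hedgehog_continuous_on g compact_Icc)
  then obtain B where "\<forall>y\<in>?g ` {0..2 * pi}. norm y \<le> B"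
    unfolding bounded_iff by blast
  then have B: "\<bar>?g t\<bar> \<le> B" if "t \<in> {0..2 * pi}" for t
    using that by auto
  have "norm (fourier_coeff f k) \<le> 2 * B * (1 / real k ^ 2)" if "k \<ge> 1" for k
  proof -
    have "norm (integral {0..2 * pi} (\<lambda>t. ?g t *\<^sub>R cis (- (real k * t)))) \<le> B * (2 * pi - 0)"
      by (rule integral_bound) (auto intro!: continuous_intros hedgehog_continuous_on[OF g] B)
    then have "norm (fourier_coeff ?g k) \<le> 2 * B"
      by (simp add: fourier_coeff_def norm_divide field_simps)
    moreover have "fourier_coeff ?g k = (\<i> * k) ^ 2 * fourier_coeff f k"
      unfolding fourier_coeff_deriv[OF hedgehog_deriv[OF assms]] fourier_coeff_deriv[OF assms]
      by (simp only: power2_eq_square mult.assoc)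
    ultimately have "real k ^ 2 * norm (fourier_coeff f k) \<le> 2 * B"
      by (simp add: norm_mult norm_power)
    with that show ?thesis by (simp add: field_simps)
  qed
  moreover have "summable (\<lambda>k. 2 * B * (1 / real k ^ 2))"
    using inverse_power_summable[of 2, where 'a=real] by (intro summable_mult) (simp add: inverse_eq_divide)
  ultimately show ?thesis
    by (intro summable_comparison_test[of "\<lambda>k. norm (fourier_coeff f k)"]) (auto intro!: exI[of _ 1])
qed

section \<open>Periodic solutions of a linear differential equation\<close>

text \<open>Imposing periodicity on the variation of constants formula determines its free constant and gives
  \<open>p\<close> as an average of the translates of \<open>q\<close> over one period with an exponential weight. Periodicity is
  then obvious; the equation follows by differentiating under the integral and integrating by parts,
  where the boundary terms give \<open>q x\<close>.\<close>

lemma periodic_linear_ode: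
  assumes q: "hedgehog q" and "a \<noteq> 0"
  obtains p where "hedgehog p" "\<And>x. deriv p x = q x - a * p x"
proof -
  define K where "K = 1 / (exp (2 * pi * a) - 1)"
  define p where "p x = K * integral (cbox 0 (2 * pi)) (\<lambda>s. exp (a * s) * q (x + s))" for x
  have K: "K * (exp (2 * pi * a) - 1) = 1"
    using \<open>a \<noteq> 0\<close> by (simp add: K_def)
  have shift1: "((\<lambda>x. q (x + s)) has_real_derivative deriv q (x + s)) (at x)" for x s
    using hedgehog_DERIV[OF q, of "x + s"] by (simp only: DERIV_shift)
  have shift2: "((\<lambda>s. q (x + s)) has_real_derivative deriv q (x + s)) (at s)" for x s
    using shift1[of x s] by (simp only: add.commute[of x])
  have cont: "continuous_on S (\<lambda>s. q (x + s))" for x S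
    using hedgehog_continuous_on[OF hedgehog_translate[OF q, of x]] by (simp only: add.commute[of x])
  \<comment> \<open>The constant \<open>K\<close> normalises the boundary terms \<open>exp (2 \<pi> a) q (x + 2 \<pi>) - q x\<close>.\<close>
  have D: "(p has_real_derivative q x - a * p x) (at x)" for x
  proof -
    have "((\<lambda>x. integral (cbox 0 (2 * pi)) (\<lambda>s. exp (a * s) * q (x + s))) has_field_derivative
        integral (cbox 0 (2 * pi)) (\<lambda>s. exp (a * s) * deriv q (x + s))) (at x within UNIV)"
    proof (rule leibniz_rule_field_derivative)
      show "((\<lambda>x. exp (a * s) * q (x + s)) has_field_derivative exp (a * s) * deriv q (x + s)) (at x within UNIV)" for x s
        by (rule DERIV_cmult[OF shift1])
      show "(\<lambda>s. exp (a * s) * q (x + s)) integrable_on cbox 0 (2 * pi)" for x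
        unfolding cbox_interval
        by (intro integrable_continuous_real continuous_intros cont)
      have "continuous_on (UNIV \<times> cbox 0 (2 * pi)) (\<lambda>y. deriv q (fst y + snd y))"
        by (rule continuous_on_compose2[OF hedgehog_continuous_on[OF hedgehog_deriv[OF q], of UNIV]])
          (auto intro!: continuous_intros)
      then show "continuous_on (UNIV \<times> cbox 0 (2 * pi)) (\<lambda>(x, s). exp (a * s) * deriv q (x + s))"
        unfolding case_prod_beta by (rule continuous_on_mult[rotated]) (intro continuous_intros)
    qed auto
    moreover have "integral (cbox 0 (2 * pi)) (\<lambda>s. exp (a * s) * deriv q (x + s)) =
        (exp (2 * pi * a) - 1) * q x - a * integral (cbox 0 (2 * pi)) (\<lambda>s. exp (a * s) * q (x + s))"
    proof -
      have "((\<lambda>s. exp (a * s) * q (x + s)) has_vector_derivative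
          a * (exp (a * s) * q (x + s)) + exp (a * s) * deriv q (x + s)) (at s within {0..2 * pi})" for s
        unfolding has_real_derivative_iff_has_vector_derivative[symmetric]
      proof (rule has_field_derivative_at_within)
        have "((\<lambda>s. exp (a * s)) has_real_derivative a * exp (a * s)) (at s)"
          by (auto intro!: derivative_eq_intros)
        from DERIV_mult[OF this shift2[of x s]]
        show "((\<lambda>s. exp (a * s) * q (x + s)) has_real_derivative
            a * (exp (a * s) * q (x + s)) + exp (a * s) * deriv q (x + s)) (at s)"
          by (simp only: mult_ac)
      qed
      then have A: "((\<lambda>s. a * (exp (a * s) * q (x + s)) + exp (a * s) * deriv q (x + s)) has_integral
          exp (a * (2 * pi)) * q (x + 2 * pi) - exp (a * 0) * q (x + 0)) {0..2 * pi}"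
        by (intro fundamental_theorem_of_calculus) auto
      have "(\<lambda>s. exp (a * s) * q (x + s)) integrable_on {0..2 * pi}"
        by (intro integrable_continuous_real continuous_intros cont)
      then have B: "((\<lambda>s. a * (exp (a * s) * q (x + s))) has_integral
          a * integral {0..2 * pi} (\<lambda>s. exp (a * s) * q (x + s))) {0..2 * pi}"
        by (intro has_integral_mult_right integrable_integral)
      show ?thesis
        using integral_unique[OF has_integral_diff[OF A B]]
        unfolding hedgehog_periodic[OF q] by (simp add: algebra_simps)
    qed
    ultimately have "(p has_real_derivative K * ((exp (2 * pi * a) - 1) * q x -
        a * integral (cbox 0 (2 * pi)) (\<lambda>s. exp (a * s) * q (x + s)))) (at x)"
      unfolding p_def by (auto intro: DERIV_cmult)
    also have "K * ((exp (2 * pi * a) - 1) * q x - a * integral (cbox 0 (2 * pi)) (\<lambda>s. exp (a * s) * q (x + s))) =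
        (K * (exp (2 * pi * a) - 1)) * q x - a * p x"
      by (simp only: p_def right_diff_distrib mult_ac)
    also have "\<dots> = q x - a * p x" by (simp only: K mult_1)
    finally show ?thesis .
  qed
  have "smooth p"
    using smooth_linear_ode[OF hedgehog_smooth[OF q], of p "- a"] D by simp
  moreover have "p (x + 2 * pi) = p x" for x
  proof -
    have "q (x + 2 * pi + s) = q (x + s)" for s
      using hedgehog_periodic[OF q, of "x + s"] by (simp add: add_ac)
    then show ?thesis by (simp add: p_def)
  qed
  ultimately have "hedgehog p" by (simp add: hedgehog_def)
  from this DERIV_imp_deriv[OF D] show thesis by (rule that)
qed

section \<open>Skew evolutes and involutes on the Fourier side\<close>

text \<open>The eigenvalue of the skew evolute map on the \<open>k\<close>th harmonics: the translation by \<open>\<alpha>\<close> contributes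
  \<open>cis (- k \<alpha>)\<close>, and the operator \<open>cos \<alpha> + sin \<alpha> d/d\<phi>\<close> contributes \<open>cos \<alpha> + i k sin \<alpha>\<close>.\<close>

definition evolute_factor :: "real \<Rightarrow> nat \<Rightarrow> complex" where
  "evolute_factor \<alpha> k = cis (- (real k * \<alpha>)) * Complex (cos \<alpha>) (real k * sin \<alpha>)"

lemma norm_evolute_factor: "norm (evolute_factor \<alpha> k) = sqrt ((cos \<alpha>)\<^sup>2 + (real k)\<^sup>2 * (sin \<alpha>)\<^sup>2)"
  by (simp only: evolute_factor_def norm_mult norm_cis) (simp add: cmod_def power_mult_distrib)

lemma norm_evolute_factor_mono: "j \<le> k \<Longrightarrow> norm (evolute_factor \<alpha> j) \<le> norm (evolute_factor \<alpha> k)"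
  unfolding norm_evolute_factor by (intro real_sqrt_le_mono add_left_mono mult_right_mono power_mono) auto

text \<open>The spectral gap: harmonics of higher order are stretched strictly more, so under iteration each of
  them outgrows all lower ones.\<close>

lemma norm_evolute_factor_strict_mono:
  "sin \<alpha> \<noteq> 0 \<Longrightarrow> j < k \<Longrightarrow> norm (evolute_factor \<alpha> j) < norm (evolute_factor \<alpha> k)"
  unfolding norm_evolute_factor
  by (intro real_sqrt_less_mono add_strict_left_mono mult_strict_right_mono power_strict_mono) auto

lemma evolute_factor_nonzero:
  assumes "cos \<alpha> \<noteq> 0"
  shows "evolute_factor \<alpha> k \<noteq> 0"
  using assms by (simp only: evolute_factor_def mult_eq_0_iff cis_neq_zero) (simp add: complex_eq_iff)

lemma skew_evolute_eq:
  "skew_evolute \<alpha> p = (\<lambda>x. cos \<alpha> * p (x + - \<alpha>) + sin \<alpha> * deriv p (x + - \<alpha>))"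
  by (simp add: fun_eq_iff skew_evolute_def)

lemma skew_evolute_hedgehog: "hedgehog p \<Longrightarrow> hedgehog (skew_evolute \<alpha> p)"
  unfolding skew_evolute_eq by (rule hedgehog_lincomb; rule hedgehog_translate) (auto intro: hedgehog_deriv)

lemma fourier_coeff_skew_evolute:
  assumes "hedgehog p"
  shows "fourier_coeff (skew_evolute \<alpha> p) k = evolute_factor \<alpha> k * fourier_coeff p k"
proof -
  have "fourier_coeff (skew_evolute \<alpha> p) k = cos \<alpha> * (cis (real k * - \<alpha>) * fourier_coeff p k) +
      sin \<alpha> * (cis (real k * - \<alpha>) * (\<i> * k * fourier_coeff p k))"
    unfolding skew_evolute_eq
      fourier_coeff_lincomb[OF hedgehog_continuous_on[OF hedgehog_translate[OF assms]]
        hedgehog_continuous_on[OF hedgehog_translate[OF hedgehog_deriv[OF assms]]]]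
      fourier_coeff_translate[OF assms] fourier_coeff_translate[OF hedgehog_deriv[OF assms]] fourier_coeff_deriv[OF assms] ..
  then show ?thesis
    by (simp add: evolute_factor_def Complex_eq algebra_simps)
qed

text \<open>In terms of the unknown \<open>p\<close>, the equation \<open>skew_evolute \<alpha> p = q\<close> is a first order linear differential
  equation with constant coefficient \<open>cot \<alpha>\<close>, whose periodic solution is given by
  \<open>periodic_linear_ode\<close>. Uniqueness is read off from the Fourier coefficients.\<close>

lemma skew_involute:
  assumes "sin \<alpha> \<noteq> 0" "cos \<alpha> \<noteq> 0" "hedgehog q"
  shows "hedgehog (skew_involute \<alpha> q)" "skew_evolute \<alpha> (skew_involute \<alpha> q) = q"
proof -
  \<comment> \<open>The second summand is \<open>0\<close>; it brings a scalar multiple into the form of a linear combination.\<close>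
  have h: "hedgehog (\<lambda>x. (1 / sin \<alpha>) * q (x + \<alpha>) + 0 * q (x + \<alpha>))"
    by (intro hedgehog_lincomb hedgehog_translate[OF assms(3)])
  have "cos \<alpha> / sin \<alpha> \<noteq> 0" using assms(1,2) by simp
  then obtain p where p: "hedgehog p"
      "\<And>x. deriv p x = (1 / sin \<alpha>) * q (x + \<alpha>) + 0 * q (x + \<alpha>) - (cos \<alpha> / sin \<alpha>) * p x"
    using periodic_linear_ode[OF h] by blast
  have "skew_evolute \<alpha> p = q"
    using assms(1) by (auto simp: skew_evolute_def p(2) field_simps fun_eq_iff)
  moreover have "p' = p" if "hedgehog p'" "skew_evolute \<alpha> p' = q" for p'
  proof (rule hedgehog_eq_fourier_coeff[OF that(1) p(1)])
    fix k
    have "evolute_factor \<alpha> k * fourier_coeff p' k = evolute_factor \<alpha> k * fourier_coeff p k"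
      unfolding fourier_coeff_skew_evolute[OF that(1), symmetric] fourier_coeff_skew_evolute[OF p(1), symmetric]
      by (simp add: that(2) calculation)
    then show "fourier_coeff p' k = fourier_coeff p k"
      using evolute_factor_nonzero[OF assms(2)] by simp
  qed
  ultimately have "\<exists>!p. hedgehog p \<and> skew_evolute \<alpha> p = q"
    using p(1) by blast
  from theI'[OF this] show "hedgehog (skew_involute \<alpha> q)" "skew_evolute \<alpha> (skew_involute \<alpha> q) = q"
    unfolding skew_involute_def by auto
qed

lemma fourier_coeff_skew_involute:
  assumes "sin \<alpha> \<noteq> 0" "cos \<alpha> \<noteq> 0" "hedgehog q"
  shows "fourier_coeff (skew_involute \<alpha> q) k = inverse (evolute_factor \<alpha> k) * fourier_coeff q k"
  using fourier_coeff_skew_evolute[OF skew_involute(1)[OF assms], of \<alpha> k] evolute_factor_nonzero[OF assms(2), of k]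
  by (simp add: skew_involute(2)[OF assms])

section \<open>Steiner point and trigonometric polynomials\<close>

text \<open>The two coordinates of the Steiner point are the first Fourier coefficients.\<close>

lemma steiner_point_eq_0_iff:
  assumes "hedgehog p"
  shows "steiner_point p = 0 \<longleftrightarrow> fourier_coeff p 1 = 0"
proof -
  have "((\<lambda>t. p t * cos t) has_integral pi * fourier_cos_coeff p 1) {0..2 * pi}"
    "((\<lambda>t. p t * sin t) has_integral pi * fourier_sin_coeff p 1) {0..2 * pi}"
    unfolding fourier_cos_coeff_def fourier_sin_coeff_def
    by (simp_all add: has_integral_integral[symmetric])
      (intro integrable_continuous_real continuous_intros hedgehog_continuous_on[OF assms])+
  from has_integral_add[OF has_integral_scaleR_left[OF this(1), of "(1 :: real, 0 :: real)"] has_integral_scaleR_left[OF this(2), of "(0 :: real, 1 :: real)"]]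
  have "((\<lambda>t. p t *\<^sub>R (cos t, sin t)) has_integral
      (pi * fourier_cos_coeff p 1, pi * fourier_sin_coeff p 1)) {0..2 * pi}"
    by simp
  then show ?thesis
    by (simp add: steiner_point_def fourier_coeff_eq[OF hedgehog_continuous_on[OF assms]] integral_unique complex_eq_iff zero_prod_def)
qed

text \<open>Orthogonality without evaluating integrals: since \<open>h'' = - j\<^sup>2 h\<close>, the coefficient satisfies
  \<open>- k\<^sup>2 c = - j\<^sup>2 c\<close>.\<close>

lemma fourier_coeff_harmonic_eq_0:
  assumes "harmonic j h" "k \<noteq> j"
  shows "fourier_coeff h k = 0"
proof -
  obtain a b where h: "h = (\<lambda>x. a * cos (real j * x) + b * sin (real j * x))"
    using assms(1) by (auto simp: harmonic_def)
  have hh: "hedgehog h" by (rule harmonic_hedgehog[OF assms(1)])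
  have "deriv (deriv h) = (\<lambda>x. - (real j)\<^sup>2 * h x + 0 * h x)"
    unfolding h deriv_harmonic by (auto simp: fun_eq_iff algebra_simps power2_eq_square)
  then have "fourier_coeff (deriv (deriv h)) k = - (real j)\<^sup>2 * fourier_coeff h k"
    using fourier_coeff_lincomb[OF hedgehog_continuous_on[OF hh] hedgehog_continuous_on[OF hh], of "- (real j)\<^sup>2" 0 k] by simp
  moreover have "fourier_coeff (deriv (deriv h)) k = (\<i> * k) ^ 2 * fourier_coeff h k"
    unfolding fourier_coeff_deriv[OF hedgehog_deriv[OF hh]] fourier_coeff_deriv[OF hh]
    by (simp only: power2_eq_square mult.assoc)
  ultimately have "((real j)\<^sup>2 - (real k)\<^sup>2) * fourier_coeff h k = 0"
    by (auto simp: power_mult_distrib algebra_simps)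
  moreover have "(real j)\<^sup>2 \<noteq> (real k)\<^sup>2"
    using assms(2) by simp
  ultimately show ?thesis by (metis eq_iff_diff_eq_0 mult_eq_0_iff of_real_diff of_real_eq_0_iff)
qed

lemma harmonic_fourier_term: "harmonic k (fourier_term f k)"
  unfolding harmonic_def
  by (rule exI[of _ "if k = 0 then fourier_cos_coeff f 0 / 2 else fourier_cos_coeff f k"],
      rule exI[of _ "fourier_sin_coeff f k"]) (simp add: fourier_term_def fun_eq_iff)

lemma fourier_coeff_sum:
  assumes "finite A" "\<And>i. i \<in> A \<Longrightarrow> hedgehog (h i)"
  shows "hedgehog (\<lambda>x. \<Sum>i\<in>A. h i x) \<and> fourier_coeff (\<lambda>x. \<Sum>i\<in>A. h i x) k = (\<Sum>i\<in>A. fourier_coeff (h i) k)"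
  using assms
proof (induction A)
  case empty
  have "hedgehog (\<lambda>x. 0)" by (rule harmonic_hedgehog[of 0]) (auto simp: harmonic_def intro!: exI[of _ 0])
  then show ?case by (simp add: fourier_coeff_def)
next
  case (insert i A)
  then have i: "hedgehog (h i)" and A: "hedgehog (\<lambda>x. \<Sum>i\<in>A. h i x)" by auto
  show ?case
    using insert hedgehog_lincomb[OF i A, of 1 1]
      fourier_coeff_lincomb[OF hedgehog_continuous_on[OF i] hedgehog_continuous_on[OF A], of 1 1]
    by simp
qed

text \<open>By orthogonality \<open>p\<close> and its summand of order \<open>d\<close> have the same \<open>d\<close>th Fourier term, and this
  summand is the sum of its own Fourier series, which has only that term.\<close>

lemma trig_polynomial_fourier_coeff:
  assumes "trig_polynomial_of_degree d p"
  shows "fourier_term p d \<noteq> (\<lambda>x. 0)" "\<And>k. k > d \<Longrightarrow> fourier_coeff p k = 0"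
proof -
  obtain h where h: "\<And>k. k \<le> d \<Longrightarrow> harmonic k (h k)" "h d \<noteq> (\<lambda>x. 0)" and p: "p = (\<lambda>x. \<Sum>k\<le>d. h k x)"
    using assms by (auto simp: trig_polynomial_of_degree_def)
  have hh: "hedgehog (h k)" if "k \<le> d" for k
    using h(1)[OF that] by (rule harmonic_hedgehog)
  have hp: "hedgehog p" and coeffp: "fourier_coeff p k = (\<Sum>j\<le>d. fourier_coeff (h j) k)" for k
    unfolding p using fourier_coeff_sum[of "{..d}" h k] hh by auto
  show "fourier_coeff p k = 0" if "k > d" for k
    unfolding coeffp using that h(1) by (intro sum.neutral ballI fourier_coeff_harmonic_eq_0) auto
  have "fourier_coeff p d = (\<Sum>j\<in>{d}. fourier_coeff (h j) d)"
    unfolding coeffp using h(1) by (intro sum.mono_neutral_right) (auto intro: fourier_coeff_harmonic_eq_0)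
  then have *: "fourier_term p d x = fourier_term (h d) d x" for x
    using fourier_term_eq[OF hedgehog_continuous_on[OF hp], of d x]
      fourier_term_eq[OF hedgehog_continuous_on[OF hh[OF order_refl]], of d x] by simp
  have "fourier_term (h d) k x = 0" if "k \<noteq> d" for k x
    using fourier_term_eq[OF hedgehog_continuous_on[OF hh[OF order_refl]], of k x]
      fourier_coeff_harmonic_eq_0[OF h(1)[OF order_refl] that] by simp
  then have "(\<lambda>k. fourier_term (h d) k x) sums fourier_term (h d) d x" for x
    using sums_finite[of "{d}" "\<lambda>k. fourier_term (h d) k x"] by simp
  then have "h d x = fourier_term p d x" for x
    using fourier_sums[OF hh[OF order_refl], of x] sums_unique2 * by metis
  then show "fourier_term p d \<noteq> (\<lambda>x. 0)"
    using h(2) by auto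
qed

section \<open>Dominance of one harmonic\<close>

text \<open>The numbers \<open>c n\<close> and angles \<open>\<theta> n\<close> undo the effect of the \<open>n\<close>th iterate on the \<open>d\<close>th harmonic. They
  multiply every other coefficient that is present by a number of modulus at most
  \<open>(\<rho> / norm (w d)) ^ n\<close>, so the deviation from the \<open>d\<close>th Fourier term is at most this geometric factor
  times the sum of the moduli of all coefficients, uniformly in the angle.\<close>

lemma uniform_limit_dominant_harmonic:
  fixes c \<theta> :: "nat \<Rightarrow> real" and w :: "nat \<Rightarrow> complex"
  assumes f: "hedgehog f" and P: "\<And>n. hedgehog (P n)"
    and coeffP: "\<And>n k. fourier_coeff (P n) k = w k ^ n * fourier_coeff f k"
    and dom: "\<And>k. k \<noteq> d \<Longrightarrow> fourier_coeff f k \<noteq> 0 \<Longrightarrow> norm (w k) \<le> \<rho>" "0 \<le> \<rho>" "\<rho> < norm (w d)"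
    and norm1: "\<And>n. c n * w d ^ n * cis (- (real d * \<theta> n)) = 1"
  shows "uniform_limit UNIV (\<lambda>n \<phi>. c n * P n (\<phi> - \<theta> n)) (fourier_term f d) sequentially"
proof -
  define M where "M = (\<Sum>k. norm (fourier_coeff f k))"
  have M: "(\<lambda>k. norm (fourier_coeff f k)) sums M"
    unfolding M_def using fourier_coeff_summable[OF f] by (rule summable_sums)
  have c: "\<bar>c n\<bar> * norm (w d) ^ n = 1" for n
    using arg_cong[OF norm1[of n], of norm] by (simp add: norm_mult norm_power)
  have bound: "\<bar>c n * P n (\<phi> - \<theta> n) - fourier_term f d \<phi>\<bar> \<le> (\<rho> / norm (w d)) ^ n * M" for n \<phi>
  proof -
    define t where "t k = c n * fourier_term (P n) k (\<phi> - \<theta> n)" for k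
    define \<epsilon> where "\<epsilon> k = (if k = 0 then 1 / 2 else 1 :: real)" for k :: nat
    have t: "t k = \<epsilon> k * Re (c n * w k ^ n * cis (- (real k * \<theta> n)) * (fourier_coeff f k * cis (real k * \<phi>)))" for k
    proof -
      have "cis (real k * (\<phi> - \<theta> n)) = cis (- (real k * \<theta> n)) * cis (real k * \<phi>)"
        by (simp add: cis_mult algebra_simps)
      moreover have "r * (e * Re z) = e * Re (complex_of_real r * z)" for r e z
        by simp
      ultimately have "t k = \<epsilon> k * Re (c n * (w k ^ n * fourier_coeff f k * (cis (- (real k * \<theta> n)) * cis (real k * \<phi>))))"
        unfolding t_def \<epsilon>_def fourier_term_eq[OF hedgehog_continuous_on[OF P]] coeffP by (simp only:)
      then show ?thesis by (simp only: mult_ac)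
    qed
    have "t d = fourier_term f d \<phi>"
      unfolding t norm1 fourier_term_eq[OF hedgehog_continuous_on[OF f]] \<epsilon>_def by simp
    moreover have "t sums (c n * P n (\<phi> - \<theta> n))"
      unfolding t_def by (intro sums_mult fourier_sums P)
    ultimately have "(\<lambda>k. t k - (if k = d then t k else 0)) sums (c n * P n (\<phi> - \<theta> n) - fourier_term f d \<phi>)"
      using sums_diff[of t _ "\<lambda>k. if k = d then t k else 0"] sums_single[of d t] by simp
    moreover have "norm (t k - (if k = d then t k else 0)) \<le> (\<rho> / norm (w d)) ^ n * norm (fourier_coeff f k)" for k
    proof (cases "k = d \<or> fourier_coeff f k = 0")
      case True
      then show ?thesis using dom(2) by (auto simp: t)
    next
      case False
      have "\<bar>t k\<bar> \<le> \<epsilon> k * norm (c n * w k ^ n * cis (- (real k * \<theta> n)) * (fourier_coeff f k * cis (real k * \<phi>)))"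
        unfolding t abs_mult by (intro mult_mono abs_Re_le_cmod) (auto simp: \<epsilon>_def)
      also have "\<dots> \<le> 1 * norm (c n * w k ^ n * cis (- (real k * \<theta> n)) * (fourier_coeff f k * cis (real k * \<phi>)))"
        by (intro mult_right_mono) (auto simp: \<epsilon>_def)
      also have "\<dots> = \<bar>c n\<bar> * norm (w k) ^ n * norm (fourier_coeff f k)"
        by (simp add: norm_mult norm_power)
      also have "\<dots> \<le> \<bar>c n\<bar> * \<rho> ^ n * norm (fourier_coeff f k)"
        using False dom(1)[of k] by (intro mult_right_mono mult_left_mono power_mono) auto
      also have "\<bar>c n\<bar> = 1 / norm (w d) ^ n"
        using c[of n] by (metis mult_eq_0_iff nonzero_eq_divide_eq zero_neq_one)
      finally show ?thesis using False by (simp add: power_divide)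
    qed
    ultimately have "norm (c n * P n (\<phi> - \<theta> n) - fourier_term f d \<phi>) \<le> (\<rho> / norm (w d)) ^ n * M"
      by (rule norm_sums_le[OF _ sums_mult[OF M]])
    then show ?thesis by simp
  qed
  have "(\<lambda>n. (\<rho> / norm (w d)) ^ n * M) \<longlonglongrightarrow> 0 * M"
    using dom(2,3) by (intro tendsto_mult tendsto_const LIMSEQ_power_zero) (auto simp: divide_simps)
  then have lim: "(\<lambda>n. (\<rho> / norm (w d)) ^ n * M) \<longlonglongrightarrow> 0" by simp
  show ?thesis
  proof (rule uniform_limitI)
    fix e :: real assume "e > 0"
    then have "eventually (\<lambda>n. (\<rho> / norm (w d)) ^ n * M < e) sequentially"
      by (rule order_tendstoD(2)[OF lim])
    then show "\<forall>\<^sub>F n in sequentially. \<forall>\<phi>\<in>UNIV. dist (c n * P n (\<phi> - \<theta> n)) (fourier_term f d \<phi>) < e"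
      by eventually_elim (auto simp: dist_real_def intro: le_less_trans[OF bound])
  qed
qed

lemma deriv_fourier_term:
  assumes "hedgehog f"
  shows "deriv (fourier_term f k) = fourier_term (deriv f) k"
proof -
  have *: "fourier_cos_coeff (deriv f) k = k * fourier_sin_coeff f k"
    "fourier_sin_coeff (deriv f) k = - (k * fourier_cos_coeff f k)"
    using fourier_coeff_deriv[OF assms, of k]
    by (simp_all add: fourier_coeff_eq[OF hedgehog_continuous_on[OF assms]]
        fourier_coeff_eq[OF hedgehog_continuous_on[OF hedgehog_deriv[OF assms]]] complex_eq_iff)
  show ?thesis
  proof (cases "k = 0")
    case True
    then show ?thesis using * by (auto simp: fourier_term_def[abs_def])
  next
    case False
    then have "fourier_term f k = (\<lambda>x. fourier_cos_coeff f k * cos (real k * x) + fourier_sin_coeff f k * sin (real k * x))"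
      by (simp add: fun_eq_iff fourier_term_def)
    then show ?thesis
      using False by (simp only: deriv_harmonic) (auto simp: fourier_term_def * fun_eq_iff)
  qed
qed

text \<open>The values at \<open>0\<close> and at a quarter period give the cosine and the sine coefficient.\<close>

lemma fourier_term_eq_0:
  assumes "hedgehog f" "fourier_term f k = (\<lambda>x. 0)"
  shows "fourier_coeff f k = 0"
proof (cases "k = 0")
  case True
  then show ?thesis
    using fun_cong[OF assms(2), of 0]
    by (simp add: fourier_coeff_eq[OF hedgehog_continuous_on[OF assms(1)]] complex_eq_iff fourier_term_def fourier_sin_coeff_def)
next
  case False
  then show ?thesis
    using fun_cong[OF assms(2), of 0] fun_cong[OF assms(2), of "pi / (2 * k)"]
    by (simp add: fourier_coeff_eq[OF hedgehog_continuous_on[OF assms(1)]] complex_eq_iff fourier_term_def)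
qed

text \<open>Common form of both parts. A rotation by \<open>n Arg (w d) / d\<close> compensates the argument of \<open>w d ^ n\<close>; for
  \<open>d = 0\<close> rotations do not change the harmonic, and a scaling, possibly negative, must do it alone, which it can
  because \<open>w 0\<close> is real. The derivatives have coefficients of the same form with the same \<open>w\<close>, so
  \<open>uniform_limit_dominant_harmonic\<close> applies to them with the same scalings and rotations.\<close>

lemma converges_in_shape_dominant_harmonic:
  assumes f: "hedgehog f" and P: "\<And>n. hedgehog (P n)"
    and coeffP: "\<And>n k. fourier_coeff (P n) k = w k ^ n * fourier_coeff f k" and "fourier_coeff f 1 = 0"
    and dom: "\<And>k. k \<noteq> d \<Longrightarrow> fourier_coeff f k \<noteq> 0 \<Longrightarrow> norm (w k) \<le> \<rho>" "0 \<le> \<rho>" "\<rho> < norm (w d)"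
    and real0: "d = 0 \<Longrightarrow> Im (w d) = 0"
  shows "converges_in_shape P (fourier_term f d)"
proof -
  have wd: "w d \<noteq> 0" using dom(2,3) by auto
  obtain c \<theta> :: "nat \<Rightarrow> real" where norm1: "\<And>n. c n * w d ^ n * cis (- (real d * \<theta> n)) = 1"
  proof (cases "d = 0")
    case True
    then have "w d = Re (w d)" using real0 by (simp add: complex_eq_iff)
    then have "complex_of_real (1 / Re (w d) ^ n) * w d ^ n * cis (- (real d * 0)) = 1" for n
      using wd by (metis cis_zero minus_zero mult.right_neutral mult_zero_right nonzero_divide_eq_eq
          of_real_1 of_real_divide of_real_power power_not_zero)
    then show ?thesis by (rule that)
  next
    case False
    have "complex_of_real (1 / norm (w d) ^ n) * w d ^ n * cis (- (real d * (n * Arg (w d) / d))) = 1" for n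
    proof -
      have *: "w d ^ n = rcis (norm (w d) ^ n) (n * Arg (w d))"
        by (metis DeMoivre2 rcis_cmod_Arg)
      show ?thesis
        unfolding * using False wd by (simp add: rcis_def cis_mult)
    qed
    then show ?thesis by (rule that)
  qed
  then have "c n \<noteq> 0" for n by (metis mult_zero_left of_real_0 zero_neq_one)
  moreover have "uniform_limit UNIV (\<lambda>n \<phi>. c n * P n (\<phi> - \<theta> n)) (fourier_term f d) sequentially"
    using f P coeffP dom norm1 by (rule uniform_limit_dominant_harmonic)
  moreover have "uniform_limit UNIV (\<lambda>n \<phi>. c n * deriv (P n) (\<phi> - \<theta> n)) (fourier_term (deriv f) d) sequentially"
  proof (rule uniform_limit_dominant_harmonic[where P = "\<lambda>n. deriv (P n)" and w = w and \<rho> = \<rho>])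
    show "fourier_coeff (deriv (P n)) k = w k ^ n * fourier_coeff (deriv f) k" for n k
      by (simp add: fourier_coeff_deriv[OF P] fourier_coeff_deriv[OF f] coeffP)
    show "norm (w k) \<le> \<rho>" if "k \<noteq> d" "fourier_coeff (deriv f) k \<noteq> 0" for k
      using that dom(1) by (simp add: fourier_coeff_deriv[OF f])
  qed (use hedgehog_deriv[OF f] hedgehog_deriv[OF P] dom(2,3) norm1 in auto)
  moreover have "deriv (\<lambda>\<phi>. c n * P n (\<phi> - \<theta> n)) = (\<lambda>\<phi>. c n * deriv (P n) (\<phi> - \<theta> n))" for n
  proof (rule ext, rule DERIV_imp_deriv, rule DERIV_cmult)
    show "((\<lambda>\<phi>. P n (\<phi> - \<theta> n)) has_real_derivative deriv (P n) (\<phi> - \<theta> n)) (at \<phi>)" for \<phi>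
      using hedgehog_DERIV[OF P, of n "\<phi> + - \<theta> n"] unfolding DERIV_shift by simp
  qed
  ultimately have "(\<forall>n. c n \<noteq> 0) \<and>
      uniform_limit UNIV (\<lambda>n \<phi>. c n * P n (\<phi> - \<theta> n)) (fourier_term f d) sequentially \<and>
      uniform_limit UNIV (\<lambda>n. deriv (\<lambda>\<phi>. c n * P n (\<phi> - \<theta> n))) (deriv (fourier_term f d)) sequentially"
    by (simp add: deriv_fourier_term[OF f])
  moreover have "hedgehog (P n) \<and> steiner_point (P n) = 0" for n
    unfolding steiner_point_eq_0_iff[OF P] using P coeffP \<open>fourier_coeff f 1 = 0\<close> by simp
  moreover have "hedgehog (fourier_term f d)"
    by (rule harmonic_hedgehog[OF harmonic_fourier_term])
  ultimately show ?thesis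
    unfolding converges_in_shape_def by blast
qed

section \<open>Iterated evolutes and involutes\<close>

lemma iterate_fourier_multiplier:
  assumes T: "\<And>q. hedgehog q \<Longrightarrow> hedgehog (T q)" "\<And>q k. hedgehog q \<Longrightarrow> fourier_coeff (T q) k = w k * fourier_coeff q k"
    and "hedgehog p"
  shows "hedgehog ((T ^^ n) p) \<and> (\<forall>k. fourier_coeff ((T ^^ n) p) k = w k ^ n * fourier_coeff p k)"
  by (induction n) (use assms in \<open>auto simp: mult.assoc\<close>)

text \<open>For evolutes the highest harmonic dominates; the second largest factor that can occur is that of order
  \<open>d - 1\<close>.\<close>

lemma evolutes_converge_in_shape:
  assumes \<alpha>: "sin \<alpha> \<noteq> 0" and p: "hedgehog p" "steiner_point p = 0"
    and d: "trig_polynomial_of_degree d p" "d = 0 \<Longrightarrow> cos \<alpha> \<noteq> 0"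
  shows "converges_in_shape (\<lambda>n. (skew_evolute \<alpha> ^^ n) p) (fourier_term p d)"
proof -
  note it = iterate_fourier_multiplier[of "skew_evolute \<alpha>", OF skew_evolute_hedgehog fourier_coeff_skew_evolute p(1)]
  define \<rho> where "\<rho> = (if d = 0 then 0 else norm (evolute_factor \<alpha> (d - 1)))"
  show ?thesis
  proof (rule converges_in_shape_dominant_harmonic[where w = "evolute_factor \<alpha>" and \<rho> = \<rho>])
    show "norm (evolute_factor \<alpha> k) \<le> \<rho>" if "k \<noteq> d" "fourier_coeff p k \<noteq> 0" for k
    proof -
      have "k < d" using trig_polynomial_fourier_coeff(2)[OF d(1), of k] that by (meson linorder_neqE_nat)
      then show ?thesis by (auto simp: \<rho>_def intro: norm_evolute_factor_mono)
    qed
    show "\<rho> < norm (evolute_factor \<alpha> d)"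
      using norm_evolute_factor_strict_mono[OF \<alpha>, of "d - 1" d] evolute_factor_nonzero[OF d(2)]
      by (auto simp: \<rho>_def)
    show "0 \<le> \<rho>" by (simp add: \<rho>_def)
    show "Im (evolute_factor \<alpha> d) = 0" if "d = 0"
      using that by (simp add: evolute_factor_def)
  qed (use it p steiner_point_eq_0_iff in auto)
qed

text \<open>For involutes the factors are inverted, and the lowest harmonic dominates.\<close>

lemma involutes_converge_in_shape:
  assumes \<alpha>: "sin \<alpha> \<noteq> 0" "cos \<alpha> \<noteq> 0" and p: "hedgehog p" "steiner_point p = 0"
    and d: "\<And>k. k < d \<Longrightarrow> fourier_term p k = (\<lambda>x. 0)"
  shows "converges_in_shape (\<lambda>n. (skew_involute \<alpha> ^^ n) p) (fourier_term p d)"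
proof -
  note it = iterate_fourier_multiplier[of "skew_involute \<alpha>", OF skew_involute(1)[OF \<alpha>] fourier_coeff_skew_involute[OF \<alpha>] p(1)]
  define \<rho> where "\<rho> = norm (inverse (evolute_factor \<alpha> (Suc d)))"
  have pos: "norm (evolute_factor \<alpha> k) > 0" for k
    using evolute_factor_nonzero[OF \<alpha>(2)] by simp
  show ?thesis
  proof (rule converges_in_shape_dominant_harmonic[where w = "\<lambda>k. inverse (evolute_factor \<alpha> k)" and \<rho> = \<rho>])
    show "norm (inverse (evolute_factor \<alpha> k)) \<le> \<rho>" if "k \<noteq> d" "fourier_coeff p k \<noteq> 0" for k
    proof -
      have "Suc d \<le> k"
        using fourier_term_eq_0[OF p(1) d, of k] that by (meson Suc_leI linorder_neqE_nat)
      then show ?thesis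
        unfolding \<rho>_def norm_inverse by (intro le_imp_inverse_le norm_evolute_factor_mono pos)
    qed
    show "\<rho> < norm (inverse (evolute_factor \<alpha> d))"
      unfolding \<rho>_def norm_inverse
      by (intro less_imp_inverse_less norm_evolute_factor_strict_mono \<alpha>(1) pos) simp
    show "0 \<le> \<rho>" by (simp add: \<rho>_def)
    show "Im (inverse (evolute_factor \<alpha> d)) = 0" if "d = 0"
      using that by (simp add: evolute_factor_def)
  qed (use it p steiner_point_eq_0_iff in auto)
qed

theorem theorem1:
  fixes \<alpha> :: real and p :: "real \<Rightarrow> real"
  assumes "sin \<alpha> \<noteq> 0"
    and "hedgehog p"
    and "p \<noteq> (\<lambda>\<phi>. 0)"
    and "steiner_point p = 0"
  shows "(\<forall>d. trig_polynomial_of_degree d p \<and> (d = 0 \<longrightarrow> cos \<alpha> \<noteq> 0) \<longrightarrow>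
            (\<exists>h. hypocycloid d h \<and> converges_in_shape (\<lambda>n. (skew_evolute \<alpha> ^^ n) p) h)) \<and>
         (cos \<alpha> \<noteq> 0 \<longrightarrow>
            (fourier_term p 0 \<noteq> (\<lambda>\<phi>. 0) \<longrightarrow>
               (\<exists>h. circle h \<and> converges_in_shape (\<lambda>n. (skew_involute \<alpha> ^^ n) p) h)) \<and>
            (\<forall>d\<ge>2. (\<forall>k<d. fourier_term p k = (\<lambda>\<phi>. 0)) \<and> fourier_term p d \<noteq> (\<lambda>\<phi>. 0) \<longrightarrow>
               (\<exists>h. hypocycloid d h \<and> converges_in_shape (\<lambda>n. (skew_involute \<alpha> ^^ n) p) h)))"
proof (intro conjI allI impI)
  fix d assume d: "trig_polynomial_of_degree d p \<and> (d = 0 \<longrightarrow> cos \<alpha> \<noteq> 0)"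
  then have ne: "fourier_term p d \<noteq> (\<lambda>x. 0)" by (blast dest: trig_polynomial_fourier_coeff(1))
  \<comment> \<open>The degree cannot be \<open>1\<close>, because the Steiner point is the origin.\<close>
  have "fourier_coeff p 1 = 0"
    using assms(2,4) steiner_point_eq_0_iff by blast
  then have "fourier_term p 1 = (\<lambda>x. 0)"
    by (simp add: fun_eq_iff fourier_term_eq[OF hedgehog_continuous_on[OF assms(2)]])
  with ne have "hypocycloid d (fourier_term p d)"
    by (auto simp: hypocycloid_def harmonic_fourier_term)
  then show "\<exists>h. hypocycloid d h \<and> converges_in_shape (\<lambda>n. (skew_evolute \<alpha> ^^ n) p) h"
    using evolutes_converge_in_shape[OF assms(1,2,4)] d by blast
next
  assume \<alpha>: "cos \<alpha> \<noteq> 0" and ne: "fourier_term p 0 \<noteq> (\<lambda>\<phi>. 0)"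
  then have "circle (fourier_term p 0)"
    unfolding hypocycloid_0_iff_circle[symmetric] by (simp add: hypocycloid_def harmonic_fourier_term)
  then show "\<exists>h. circle h \<and> converges_in_shape (\<lambda>n. (skew_involute \<alpha> ^^ n) p) h"
    using involutes_converge_in_shape[OF assms(1) \<alpha> assms(2,4), of 0] by blast
next
  fix d :: nat
  assume \<alpha>: "cos \<alpha> \<noteq> 0" and "2 \<le> d"
    and d: "(\<forall>k<d. fourier_term p k = (\<lambda>\<phi>. 0)) \<and> fourier_term p d \<noteq> (\<lambda>\<phi>. 0)"
  then have "hypocycloid d (fourier_term p d)"
    by (simp add: hypocycloid_def harmonic_fourier_term)
  then show "\<exists>h. hypocycloid d h \<and> converges_in_shape (\<lambda>n. (skew_involute \<alpha> ^^ n) p) h"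
    using involutes_converge_in_shape[OF assms(1) \<alpha> assms(2,4), of d] d by blast
qed

end
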